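(* Let $\mathscr G_c^+$ be the extended weighted communication graph on the node set $\mathcal V=\{1,\dots,n\}$, with weighted incidence matrix $D_c^+$ and edge weights $\eta_{ij}=\kappa_{k_i}/\kappa_{k_j}$, where $\kappa_{k_i}>0$ is the participation factor of the cell $k_i$ containing node $i$. Let $\lambda\in\mathbb R^n$ satisfy $(D_c^+)^\top\lambda=0$. If $\mathscr G_c^+$ is weakly connected, then $$\frac{\lambda_1}{\kappa_{k_1}}=\frac{\lambda_2}{\kappa_{k_2}}=\cdots=\frac{\lambda_n}{\kappa_{k_n}}.$$ (This common value is denoted $\Lambda^\circ$.)
   Context: The nodes $\mathcal V=\{1,\dots,n\}$ are partitioned into cells $k\in\mathcal Z$; $k_i\in\mathcal Z$ denotes the cell containing node $i$. Each cell $k$ has a participation factor $\kappa_k>0$. The directed graph $\mathscr G_c^+$ has edges inside cells (for each cell, these form a connected graph on the nodes of the cell) and possibly additional edges joining nodes of different cells. Each edge $(i,j)$ has a weight $\eta_{ij}>0$: $\eta_{ij}=1$ if $i$ and $j$ lie in the same cell, and $\eta_{ij}=\kappa_{k_i}/\kappa_{k_j}$ if they lie in different cells (this is the standing feasibility assumption on the weights, which guarantees that some $\lambda>0$ satisfies $(D_c^+)^\top\lambda=0$). The weighted incidence matrix $D_c^+$ has one column per edge, such that the component of $(D_c^+)^\top\lambda$ belonging to the edge $(i,j)$ is $\lambda_i-\eta_{ij}\lambda_j$; thus $(D_c^+)^\top\lambda=0$ expresses the price constraints $\lambda_i=\eta_{ij}\lambda_j$ for all edges $(i,j)$. Weakly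 connected means that the underlying undirected graph is connected. *)

theory Defs
  imports "Jordan_Normal_Form.Matrix" "Graph_Theory.Digraph_Component" "HOL-Library.Disjoint_Sets"
begin

(* Vectors and matrices of Jordan_Normal_Form are indexed from 0, so the n nodes are 0, ..., n - 1. *)

definition cell_of :: "nat set set \<Rightarrow> nat \<Rightarrow> nat set" where
  "cell_of Z i = (THE k. k \<in> Z \<and> i \<in> k)"

(* The constant Digraph_Component.connected refers to the symmetric closure of a digraph, i.e. it
   is weak connectedness. The bare name would clash with topological connectedness. *)

locale cellular_comm_graph = pair_fin_digraph G
  for G :: "nat pair_pre_digraph" +
  fixes n :: nat
    and Z :: "nat set set"
    and \<kappa> :: "nat set \<Rightarrow> real"
    and \<eta> :: "nat \<Rightarrow> nat \<Rightarrow> real"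
  assumes nodes: "pverts G = {0..<n}"
    and cells: "partition_on {0..<n} Z"
    and participation_pos: "k \<in> Z \<Longrightarrow> \<kappa> k > 0"
    and cell_connected: "k \<in> Z \<Longrightarrow> Digraph_Component.connected (with_proj G \<restriction> k)"
    and weight_pos: "(i, j) \<in> parcs G \<Longrightarrow> \<eta> i j > 0"
    and weight_same_cell:
      "(i, j) \<in> parcs G \<Longrightarrow> cell_of Z i = cell_of Z j \<Longrightarrow> \<eta> i j = 1"
    and weight_diff_cell:
      "(i, j) \<in> parcs G \<Longrightarrow> cell_of Z i \<noteq> cell_of Z j \<Longrightarrow>
        \<eta> i j = \<kappa> (cell_of Z i) / \<kappa> (cell_of Z j)"

(* The list es enumerates the edges and thereby fixes the order of the columns. *)

definition weighted_incidence_mat ::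
  "nat \<Rightarrow> (nat \<Rightarrow> nat \<Rightarrow> real) \<Rightarrow> (nat \<times> nat) list \<Rightarrow> real mat" where
  "weighted_incidence_mat n \<eta> es =
    mat n (length es) (\<lambda>(v, e). case es ! e of (i, j) \<Rightarrow> of_bool (v = i) - \<eta> i j * of_bool (v = j))"

lemma transpose_weighted_incidence_mat_component:
  assumes "x \<in> carrier_vec n" and "e < length es" and "es ! e = (i, j)" and "i < n" and "j < n"
  shows "(transpose_mat (weighted_incidence_mat n \<eta> es) *\<^sub>v x) $ e = x $ i - \<eta> i j * x $ j"
proof -
  have "(transpose_mat (weighted_incidence_mat n \<eta> es) *\<^sub>v x) $ e
      = (\<Sum>v\<in>{0..<n}. (of_bool (v = i) - \<eta> i j * of_bool (v = j)) * x $ v)"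
    using assms by (simp add: weighted_incidence_mat_def scalar_prod_def)
  also have "\<dots> = (\<Sum>v\<in>{0..<n}. (if v = i then x $ v else 0) - (if v = j then \<eta> i j * x $ v else 0))"
    by (intro sum.cong) (auto simp: algebra_simps)
  also have "\<dots> = x $ i - \<eta> i j * x $ j"
    using assms by (simp add: sum_subtractf)
  finally show ?thesis .
qed

lemma cell_of_eq:
  assumes "partition_on A Z" and "k \<in> Z" and "i \<in> k"
  shows "cell_of Z i = k"
  unfolding cell_of_def
proof (rule the_equality)
  show "k' = k" if "k' \<in> Z \<and> i \<in> k'" for k'
    using assms that by (auto simp: partition_on_def disjoint_def)
qed (use assms in simp)

end

theory Submission
  imports Defs
begin

text \<open>The weights form a potential ratio: \<open>\<eta> i j\<close> is the quotient of the
  participation factors of the two end cells on every edge, inside cells as well as between them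
  (\<open>weight_eq_ratio\<close>). Dividing the price constraint of an edge by the positive factor
  at its tail therefore says that the normalised price takes the same value at both ends
  (\<open>arc_price_ratio\<close>). A function that agrees across every edge is constant on a weakly
  connected graph (\<open>connected_imp_constant\<close>).\<close>

lemma (in cellular_comm_graph) participation_pos_node:
  assumes "i < n"
  shows "\<kappa> (cell_of Z i) > 0"
proof -
  have "i \<in> \<Union>Z"
    using assms unfolding partition_onD1[OF cells, symmetric] by simp
  then obtain k where "k \<in> Z" "i \<in> k"
    by blast
  then show ?thesis
    using cell_of_eq[OF cells] participation_pos by auto
qed

text \<open>Inside a cell the weight 1 is the quotient of a factor by itself, so the two cases of
  the weight assumption merge into one formula.\<close>

lemma (in cellular_comm_graph) weight_eq_ratio:
  assumes "(i, j) \<in> parcs G"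
  shows "\<eta> i j = \<kappa> (cell_of Z i) / \<kappa> (cell_of Z j)"
proof (cases "cell_of Z i = cell_of Z j")
  case True
  \<comment> \<open>The quotient \<open>x / x\<close> is 1 only for nonzero \<open>x\<close>, so
    positivity at the node \<open>i\<close> is called for.\<close>
  have "i < n"
    using assms in_arcsD1 nodes by auto
  with True show ?thesis
    using weight_same_cell[OF assms] participation_pos_node[of i] by simp
qed (rule weight_diff_cell[OF assms])

lemma (in cellular_comm_graph) arc_price_ratio:
  assumes "set es = parcs G" and "l \<in> carrier_vec n"
    and "transpose_mat (weighted_incidence_mat n \<eta> es) *\<^sub>v l = 0\<^sub>v (length es)"
    and "(i, j) \<in> parcs G"
  shows "l $ i / \<kappa> (cell_of Z i) = l $ j / \<kappa> (cell_of Z j)"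
proof -
  obtain e where e: "e < length es" "es ! e = (i, j)"
    using assms(1,4) by (metis in_set_conv_nth)
  have ij: "i < n" "j < n"
    using assms(4) in_arcsD1 in_arcsD2 nodes by auto
  \<comment> \<open>This is the zero entry of the product at column \<open>e\<close>.\<close>
  have "l $ i = \<kappa> (cell_of Z i) / \<kappa> (cell_of Z j) * l $ j"
    using transpose_weighted_incidence_mat_component[OF assms(2) e ij, of \<eta>] assms(3) e(1)
      weight_eq_ratio[OF assms(4)] by simp
  then show ?thesis
    using ij[THEN participation_pos_node] by (simp add: field_simps)
qed

text \<open>Induction along a path in the symmetric closure: equality of values is symmetric, so
  traversing an arc backwards preserves the value too.\<close>

lemma connected_imp_constant:
  assumes "Digraph_Component.connected G" and "u \<in> verts G" and "v \<in> verts G"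
    and arc: "\<And>a. a \<in> arcs G \<Longrightarrow> f (tail G a) = f (head G a)"
  shows "f u = f v"
proof -
  have "u \<rightarrow>\<^sup>*\<^bsub>with_proj (mk_symmetric G)\<^esub> v"
    using assms(1-3) unfolding connected_def strongly_connected_def by simp
  then show ?thesis
    unfolding reachable_def
  proof (induction rule: rtrancl_on_induct)
    case (step v w)
    \<comment> \<open>Each step of the path comes from an arc of the original graph, in one of its
      two directions.\<close>
    then obtain a where "a \<in> arcs G"
      and "(v, w) = (tail G a, head G a) \<or> (v, w) = (head G a, tail G a)"
      by (auto simp: parcs_mk_symmetric)
    then have "f v = f w"
      using arc[of a] by auto
    with step.IH show ?case
      by simp
  qed simp
qed

theorem proposition2:
  fixes G :: "nat pair_pre_digraph" and n :: nat and Z :: "nat set set"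
    and \<kappa> :: "nat set \<Rightarrow> real" and \<eta> :: "nat \<Rightarrow> nat \<Rightarrow> real"
    and es :: "(nat \<times> nat) list" and l :: "real vec"
  assumes "cellular_comm_graph G n Z \<kappa> \<eta>"
    and "distinct es" and "set es = parcs G"
    and "l \<in> carrier_vec n"
    and "transpose_mat (weighted_incidence_mat n \<eta> es) *\<^sub>v l = 0\<^sub>v (length es)"
    and "Digraph_Component.connected (with_proj G)"
  shows "\<forall>i<n. \<forall>j<n. l $ i / \<kappa> (cell_of Z i) = l $ j / \<kappa> (cell_of Z j)"
proof (intro allI impI)
  interpret cellular_comm_graph G n Z \<kappa> \<eta>
    by fact
  let ?f = "\<lambda>i. l $ i / \<kappa> (cell_of Z i)"
  fix i j assume "i < n" "j < n"
  then have "i \<in> verts (with_proj G)" "j \<in> verts (with_proj G)"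
    using nodes by auto
  moreover have "?f (tail (with_proj G) a) = ?f (head (with_proj G) a)"
    if "a \<in> arcs (with_proj G)" for a
    using arc_price_ratio[OF assms(3-5), of "fst a" "snd a"] that by simp
  ultimately show "?f i = ?f j"
    by (rule connected_imp_constant[OF assms(6), where f = ?f])
qed

end
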